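(* Let $K$ be a field of arbitrary characteristic, and let $$A_1=\frac{K[X,Y,Z]}{(f(X)Y-\varphi_1(X,Z))},\qquad A_2=\frac{K[X,Y,Z]}{(g(X)Y-\varphi_2(X,Z))},$$ where $f,g\in K[X]$ have degree at least $2$, and $\varphi_1,\varphi_2\in K[X,Z]$ are monic in $Z$ with $d_1:=\deg_Z(\varphi_1)\ge 2$ and $d_2:=\deg_Z(\varphi_2)\ge 2$. For $i=1,2$ let $x_i,y_i,z_i$ denote the images of $X,Y,Z$ in $A_i$. Let $n$ and $m$ be the numbers of distinct prime factors (up to associates) of $f(x_1)$ in $K[x_1]$ and of $g(x_2)$ in $K[x_2]$, respectively. Let $T:A_1\to A_2$ be a $K$-algebra homomorphism such that $T(x_1)=\lambda x_2+\mu$ and $T(z_1)=\gamma z_2+\delta$ for some $\lambda,\gamma\in K^*$, $\mu\in K$ and $\delta\in K[x_2]$, and suppose that $n=m$ and $d_1=d_2$. Then the following are equivalent: (I) $T$ is an isomorphism. (II) $T\big((f(x_1),\varphi_1(x_1,z_1))K[x_1,z_1]\big)=(g(x_2),\varphi_2(x_2,z_2))K[x_2,z_2]$. (III) $T(f(x_1))=u\,g(x_2)$ for some unit $u$ in $K$.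
   Context: $K^*=K\setminus\{0\}$. For elements $a,b$ of a ring $R$, $(a,b)R$ denotes the ideal of $R$ generated by $a$ and $b$. The elements $x_i,z_i$ of $A_i$ are algebraically independent over $K$, so $K[x_i]$ and $K[x_i,z_i]$ are polynomial rings. *)

theory Defs
  imports "HOL-Algebra.Algebra" "HOL-Algebra.Algebraic_Closure_Type"
begin

text \<open>
  The field \<open>K\<close> is an arbitrary type \<open>'k\<close> of class \<^class>\<open>field\<close>. The ring \<open>K[X,Y,Z]\<close> is built as
  \<open>K[X][Z][Y]\<close>, i.e. as the type \<open>'k poly poly poly\<close>, with \<open>X\<close> innermost and \<open>Y\<close> outermost.
  Thus \<open>'k poly\<close> is \<open>K[X]\<close>, and \<open>'k poly poly\<close> is \<open>K[X,Z]\<close> viewed as \<open>K[X][Z]\<close>, so that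
  \<open>deg\<^sub>Z\<close> is the outer degree and ``monic in \<open>Z\<close>'' means that the outer leading coefficient is \<open>1\<close>.
\<close>

definition of_KXZ :: "'k::field poly poly \<Rightarrow> 'k poly poly poly"
  where "of_KXZ p = [:p:]"

definition of_KX :: "'k::field poly \<Rightarrow> 'k poly poly poly"
  where "of_KX p = of_KXZ [:p:]"

definition of_K :: "'k::field \<Rightarrow> 'k poly poly poly"
  where "of_K c = of_KX [:c:]"

definition var_X :: "'k::field poly poly poly"
  where "var_X = of_KX [:0, 1:]"

definition var_Z :: "'k::field poly poly poly"
  where "var_Z = of_KXZ [:0, 1:]"

definition var_Y :: "'k::field poly poly poly"
  where "var_Y = [:0, 1:]"

definition KXYZ :: "'k::field poly poly poly ring"
  where "KXYZ = ring_of_type_algebra"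

definition rel_ideal :: "'k::field poly \<Rightarrow> 'k poly poly \<Rightarrow> 'k poly poly poly set"
  where "rel_ideal f \<phi> = genideal KXYZ {of_KX f * var_Y - of_KXZ \<phi>}"

text \<open>The ring \<open>A = K[X,Y,Z] / (f(X) Y - \<phi>(X,Z))\<close>, and the image in \<open>A\<close> of a polynomial.\<close>

definition quot_ring :: "'k::field poly \<Rightarrow> 'k poly poly \<Rightarrow> 'k poly poly poly set ring"
  where "quot_ring f \<phi> = KXYZ Quot rel_ideal f \<phi>"

definition img :: "'k::field poly \<Rightarrow> 'k poly poly \<Rightarrow> 'k poly poly poly \<Rightarrow> 'k poly poly poly set"
  where "img f \<phi> p = rel_ideal f \<phi> +>\<^bsub>KXYZ\<^esub> p"

definition scal :: "'k::field poly \<Rightarrow> 'k poly poly \<Rightarrow> 'k \<Rightarrow> 'k poly poly poly set"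
  where "scal f \<phi> c = img f \<phi> (of_K c)"

definition gen_x :: "'k::field poly \<Rightarrow> 'k poly poly \<Rightarrow> 'k poly poly poly set"
  where "gen_x f \<phi> = img f \<phi> var_X"

definition gen_z :: "'k::field poly \<Rightarrow> 'k poly poly \<Rightarrow> 'k poly poly poly set"
  where "gen_z f \<phi> = img f \<phi> var_Z"

text \<open>
  The values \<open>p(x)\<close> and \<open>q(x,z)\<close> in \<open>A\<close>: as \<open>x\<close> and \<open>z\<close> are the images of \<open>X\<close> and \<open>Z\<close>, these are the
  images of \<open>p(X)\<close> and \<open>q(X,Z)\<close>.
\<close>

definition at_x :: "'k::field poly \<Rightarrow> 'k poly poly \<Rightarrow> 'k poly \<Rightarrow> 'k poly poly poly set"
  where "at_x f \<phi> p = img f \<phi> (of_KX p)"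

definition at_xz :: "'k::field poly \<Rightarrow> 'k poly poly \<Rightarrow> 'k poly poly \<Rightarrow> 'k poly poly poly set"
  where "at_xz f \<phi> q = img f \<phi> (of_KXZ q)"

text \<open>The subrings \<open>K[x]\<close> and \<open>K[x,z]\<close> of \<open>A\<close>, as rings in their own right.\<close>

definition K_x :: "'k::field poly \<Rightarrow> 'k poly poly \<Rightarrow> 'k poly poly poly set ring"
  where "K_x f \<phi> = (quot_ring f \<phi>)
    \<lparr>carrier := generate_ring (quot_ring f \<phi>) (range (scal f \<phi>) \<union> {gen_x f \<phi>})\<rparr>"

definition K_xz :: "'k::field poly \<Rightarrow> 'k poly poly \<Rightarrow> 'k poly poly poly set ring"
  where "K_xz f \<phi> = (quot_ring f \<phi>)
    \<lparr>carrier := generate_ring (quot_ring f \<phi>) (range (scal f \<phi>) \<union> {gen_x f \<phi>, gen_z f \<phi>})\<rparr>"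

text \<open>
  The number of prime factors of \<open>a\<close> in \<open>R\<close> up to associates: each prime factor is replaced by its
  class of associates, and the classes are counted.
\<close>

definition num_prime_factors :: "('a, 'b) ring_scheme \<Rightarrow> 'a \<Rightarrow> nat"
  where "num_prime_factors R a =
    card (assocs R ` {p \<in> carrier R. ring_prime\<^bsub>R\<^esub> p \<and> p divides\<^bsub>R\<^esub> a})"

text \<open>
  As usual in \<open>HOL-Algebra\<close>, homomorphisms matter only on the carrier. The structure map of the
  \<open>K\<close>-algebra \<open>A\<close> is \<^const>\<open>scal\<close>.
\<close>

definition K_alg_hom ::
  "'k::field poly \<Rightarrow> 'k poly poly \<Rightarrow> 'k poly \<Rightarrow> 'k poly poly \<Rightarrow>
   ('k poly poly poly set \<Rightarrow> 'k poly poly poly set) set"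
  where "K_alg_hom f \<phi> g \<psi> =
    {T \<in> ring_hom (quot_ring f \<phi>) (quot_ring g \<psi>). \<forall>c. T (scal f \<phi> c) = scal g \<psi> c}"

end

theory Submission
  imports Defs
begin

text \<open>
  Write \<open>A = K[X,Z,Y] / (g(X) Y - \<psi>)\<close> with \<open>\<psi>\<close> monic of degree \<open>d\<close> in \<open>Z\<close>. Since \<open>\<psi>\<close> is monic, every
  occurrence of \<open>Z\<^sup>d\<close> can be traded for \<open>g Y\<close> plus lower powers of \<open>Z\<close>, so that every class in \<open>A\<close> has
  exactly one representative all of whose \<open>Y\<close>-coefficients have \<open>Z\<close>-degree below \<open>d\<close>
  (\<open>Z_reduced_representative\<close>, \<open>Z_reduced_multiple_eq_0\<close>). Everything rests on this normal form.
  
  On \<open>K[x\<^sub>1,z\<^sub>1]\<close> the map \<open>T\<close> is the automorphism \<open>\<sigma>\<close> of \<open>K[X,Z]\<close> with \<open>X \<mapsto> \<lambda> X + \<mu>\<close> and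
  \<open>Z \<mapsto> \<gamma> Z + \<delta>\<close>. Let \<open>W\<close> be the normal form of \<open>T(y\<^sub>1)\<close>. Applying \<open>T\<close> to \<open>f(x\<^sub>1) y\<^sub>1 = \<phi>\<^sub>1(x\<^sub>1,z\<^sub>1)\<close>
  gives \<open>\<sigma>(f) W = \<sigma>(\<phi>\<^sub>1)\<close> in \<open>A\<^sub>2\<close>. Here \<open>\<sigma>(\<phi>\<^sub>1) = \<gamma>\<^sup>d \<phi>\<^sub>2 + r\<close> with \<open>deg\<^sub>Z r < d\<close>, and \<open>\<phi>\<^sub>2 = g Y\<close> in \<open>A\<^sub>2\<close>;
  as \<open>\<sigma>(f) W\<close> and \<open>\<gamma>\<^sup>d g Y + r\<close> are both in normal form, they agree as polynomials. Hence
  \<open>W = w\<^sub>0 + w\<^sub>1 Y\<close> with \<open>\<sigma>(f) w\<^sub>1 = \<gamma>\<^sup>d g\<close> and \<open>\<sigma>(\<phi>\<^sub>1) = \<gamma>\<^sup>d \<phi>\<^sub>2 + \<sigma>(f) w\<^sub>0\<close> (\<open>T_image_of_y\<close>). In particular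
  \<open>\<sigma>(f)\<close> divides \<open>g\<close>, so (III) says precisely that \<open>deg g \<le> deg f\<close>. The other two conditions are
  now compared with (III):
  
  \<^item> If \<open>T\<close> is an isomorphism, the divisibility holds for \<open>T\<close> inverse as well, which gives \<open>deg g \<le> deg f\<close>.
  \<^item> If (III) holds, \<open>w\<^sub>1\<close> is a nonzero constant, so \<open>y\<^sub>2\<close> lies in the image of \<open>T\<close>. Injectivity of \<open>T\<close>
    follows from that of \<open>\<sigma>\<close>, because a power of the nonzerodivisor \<open>f(x\<^sub>1)\<close> moves any element of \<open>A\<^sub>1\<close>
    into \<open>K[x\<^sub>1,z\<^sub>1]\<close>.
  \<^item> If (III) holds, the formula for \<open>\<sigma>(\<phi>\<^sub>1)\<close> shows \<open>(\<sigma>(f), \<sigma>(\<phi>\<^sub>1)) = (g, \<phi>\<^sub>2)\<close> in \<open>K[X,Z]\<close>, which is (II).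
  \<^item> If (II) holds, \<open>\<sigma>(f)\<close> is an element of \<open>K[X]\<close> in the ideal \<open>(g, \<phi>\<^sub>2)\<close>, hence a multiple of \<open>g\<close>
    (\<open>dvd_if_in_KXZ_ideal\<close>, again by the normal form), so \<open>deg g \<le> deg f\<close>.
\<close>


section \<open>Normal forms modulo the defining relation\<close>

text \<open>
  The polynomial \<open>f(X) Y - \<phi>(X,Z)\<close>, written out as a polynomial in \<open>Y\<close>.
\<close>

definition rel_poly :: "'k::field poly \<Rightarrow> 'k poly poly \<Rightarrow> 'k poly poly poly"
  where "rel_poly f \<phi> = [:- \<phi>, [:f:]:]"

text \<open>
  The normal form for classes modulo \<open>f(X) Y - \<phi>\<close>, to be used with \<open>d = deg\<^sub>Z \<phi>\<close>. Bounding each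
  \<open>Y\<close>-coefficient by its degree alone is enough because \<open>d\<close> is positive, so that zero coefficients satisfy
  the bound.
\<close>

definition Z_reduced :: "nat \<Rightarrow> 'k::field poly poly poly \<Rightarrow> bool"
  where "Z_reduced d V \<longleftrightarrow> (\<forall>i. Polynomial.degree (Polynomial.coeff V i) < d)"

lemma degree_less_if_coeff_eq_0:
  "Polynomial.degree p \<le> n \<Longrightarrow> Polynomial.coeff p n = 0 \<Longrightarrow> 0 < n \<Longrightarrow> Polynomial.degree p < n"
  using eq_zero_or_degree_less[of p n] by auto

lemma Z_reduced_add: "Z_reduced d U \<Longrightarrow> Z_reduced d V \<Longrightarrow> Z_reduced d (U + V)"
  unfolding Z_reduced_def by (simp add: degree_add_less)

lemma Z_reduced_diff: "Z_reduced d U \<Longrightarrow> Z_reduced d V \<Longrightarrow> Z_reduced d (U - V)"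
  unfolding Z_reduced_def by (simp add: degree_diff_less)

lemma Z_reduced_0: "0 < d \<Longrightarrow> Z_reduced d 0"
  unfolding Z_reduced_def by simp

lemma Z_reduced_pCons:
  "Z_reduced d (pCons w V) \<longleftrightarrow> Polynomial.degree w < d \<and> Z_reduced d V"
  unfolding Z_reduced_def by (auto simp: coeff_pCons split: nat.split)

lemma Z_reduced_smult_KX:
  assumes "Z_reduced d V"
  shows "Z_reduced d (Polynomial.smult [:h:] V)"
  using assms unfolding Z_reduced_def
  by (auto intro: le_less_trans[OF degree_smult_le])

lemma rel_poly_mult:
  "rel_poly f \<phi> * Q = pCons 0 (Polynomial.smult [:f:] Q) - Polynomial.smult \<phi> Q"
  unfolding rel_poly_def by (simp add: mult_pCons_left)

text \<open>
  Let \<open>deg\<^sub>Z \<phi> > 0\<close>. In a product \<open>(f Y - \<phi>) Q\<close> with \<open>Q \<noteq> 0\<close>, take a coefficient \<open>q\<^sub>i\<close> of \<open>Q\<close> of maximal \<open>Z\<close>-degree \<open>e\<close>. The product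
  has \<open>i\<close>-th coefficient \<open>f q\<^bsub>i-1\<^esub> - \<phi> q\<^sub>i\<close>, and its \<open>Z\<close>-degree is \<open>deg\<^sub>Z \<phi> + e\<close>, since multiplication by
  \<open>f \<in> K[X]\<close> does not raise the \<open>Z\<close>-degree. So a nonzero multiple of \<open>f Y - \<phi>\<close> is never reduced, which is
  the uniqueness of normal forms.
\<close>

lemma Z_reduced_multiple_eq_0:
  fixes f :: "'k::field poly"
  assumes monic: "Polynomial.lead_coeff \<phi> = 1"
    and dvd: "rel_poly f \<phi> dvd V" and red: "Z_reduced (Polynomial.degree \<phi>) V"
  shows "V = 0"
proof (rule ccontr)
  assume "V \<noteq> 0"
  obtain Q where Q: "V = rel_poly f \<phi> * Q" using dvd by (elim dvdE)
  with \<open>V \<noteq> 0\<close> have "Q \<noteq> 0" by auto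
  define c where "c = Polynomial.coeff Q"
  define Zdeg where "Zdeg i = Polynomial.degree (c i)" for i
  have nonempty: "\<exists>i. c i \<noteq> 0"
    using \<open>Q \<noteq> 0\<close> unfolding c_def by (metis leading_coeff_0_iff)
  have "finite {i. c i \<noteq> 0}"
    unfolding c_def using MOST_coeff_eq_0[of Q] by (simp add: eventually_cofinite)
  then have fin: "finite (Zdeg ` {i. c i \<noteq> 0})" by simp
  moreover have "Zdeg ` {i. c i \<noteq> 0} \<noteq> {}" using nonempty by blast
  ultimately have "Max (Zdeg ` {i. c i \<noteq> 0}) \<in> Zdeg ` {i. c i \<noteq> 0}" by (rule Max_in)
  then obtain i where i: "c i \<noteq> 0" and "Zdeg i = Max (Zdeg ` {i. c i \<noteq> 0})" by auto
  with fin have max: "Zdeg j \<le> Zdeg i" if "c j \<noteq> 0" for j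
    using that by simp
  have Zdeg_le: "Zdeg j \<le> Zdeg i" for j
    using max[of j] by (cases "c j = 0") (auto simp: Zdeg_def)
  have "\<phi> \<noteq> 0" using monic by auto
  \<comment> \<open>If \<open>\<phi>\<close> is constant in \<open>Z\<close>, the hypothesis that \<open>V\<close> is reduced is already absurd.\<close>
  have low: "Polynomial.degree (Polynomial.coeff (pCons 0 (Polynomial.smult [:f:] Q)) i)
      < Polynomial.degree (\<phi> * c i) \<or> Polynomial.degree \<phi> = 0"
  proof (cases i)
    case 0
    then show ?thesis using \<open>\<phi> \<noteq> 0\<close> i by (auto simp: degree_mult_eq)
  next
    case (Suc j)
    have "Polynomial.degree (Polynomial.smult f (c j)) \<le> Zdeg i"
      using Zdeg_le[of j] unfolding Zdeg_def by (meson degree_smult_le order_trans)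
    then show ?thesis
      using Suc i \<open>\<phi> \<noteq> 0\<close> by (auto simp: degree_mult_eq Zdeg_def c_def)
  qed
  have "Polynomial.degree (Polynomial.coeff V i) < Polynomial.degree \<phi>"
    using red unfolding Z_reduced_def by blast
  moreover have "Polynomial.coeff V i
      = Polynomial.coeff (pCons 0 (Polynomial.smult [:f:] Q)) i - \<phi> * c i"
    unfolding Q rel_poly_mult c_def by simp
  ultimately have "Polynomial.degree (\<phi> * c i) < Polynomial.degree \<phi>"
    using low degree_add_eq_right[of "Polynomial.coeff (pCons 0 (Polynomial.smult [:f:] Q)) i" "- (\<phi> * c i)"]
    by (auto simp del: coeff_pCons)
  then show False using i \<open>\<phi> \<noteq> 0\<close> by (simp add: degree_mult_eq)
qed

text \<open>
  Division by the monic \<open>\<phi>\<close>, one leading term at a time: \<open>w\<close> is congruent to \<open>(w - \<phi> t) + f Y t\<close> for the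
  monomial \<open>t\<close> in \<open>Z\<close> that cancels the top term of \<open>w\<close>, and both \<open>w - \<phi> t\<close> and \<open>t\<close> have smaller
  \<open>Z\<close>-degree than \<open>w\<close>.
\<close>

lemma Z_reduced_representative_KXZ:
  fixes f :: "'k::field poly"
  assumes monic: "Polynomial.lead_coeff \<phi> = 1" and pos: "0 < Polynomial.degree \<phi>"
  shows "\<exists>R. Z_reduced (Polynomial.degree \<phi>) R \<and> rel_poly f \<phi> dvd [:w:] - R"
proof (induction "Polynomial.degree w" arbitrary: w rule: less_induct)
  case less
  let ?d = "Polynomial.degree \<phi>"
  show ?case
  proof (cases "Polynomial.degree w < ?d")
    case True
    then have "Z_reduced ?d [:w:]" using pos by (simp add: Z_reduced_pCons Z_reduced_0)
    then show ?thesis by (intro exI[of _ "[:w:]"]) simp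
  next
    case False
    define e where "e = Polynomial.degree w - ?d"
    define a where "a = Polynomial.lead_coeff w"
    define t where "t = Polynomial.monom a e"
    define w' where "w' = w - \<phi> * t"
    have "w \<noteq> 0" using False pos by auto
    then have "a \<noteq> 0" by (simp add: a_def)
    then have "t \<noteq> 0" by (simp add: t_def)
    have "\<phi> \<noteq> 0" using pos by auto
    have degt: "Polynomial.degree t = e" using \<open>a \<noteq> 0\<close> by (simp add: t_def degree_monom_eq)
    have deg_eq: "Polynomial.degree (\<phi> * t) = Polynomial.degree w"
      using degree_mult_eq[OF \<open>\<phi> \<noteq> 0\<close> \<open>t \<noteq> 0\<close>] degt e_def False by linarith
    have "Polynomial.lead_coeff (\<phi> * t) = Polynomial.lead_coeff w"
      unfolding lead_coeff_mult monic using degt by (simp add: t_def a_def)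
    then have w'_less: "Polynomial.degree w' < Polynomial.degree w"
      unfolding w'_def using deg_eq False pos
      by (intro degree_less_if_coeff_eq_0) (auto intro: degree_diff_le)
    have t_less: "Polynomial.degree t < Polynomial.degree w"
      using degt e_def False pos by simp
    obtain R1 where R1: "Z_reduced ?d R1" "rel_poly f \<phi> dvd [:w':] - R1"
      using less.hyps[OF w'_less] by blast
    obtain R2 where R2: "Z_reduced ?d R2" "rel_poly f \<phi> dvd [:t:] - R2"
      using less.hyps[OF t_less] by blast
    let ?R = "R1 + pCons 0 (Polynomial.smult [:f:] R2)"
    have "Z_reduced ?d ?R"
      using R1 R2 pos by (intro Z_reduced_add) (auto simp: Z_reduced_pCons intro: Z_reduced_smult_KX)
    moreover have "[:w:] - ?R = ([:w':] - R1) - rel_poly f \<phi> * [:t:]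
        + [:0, [:f:]:] * ([:t:] - R2)"
      unfolding rel_poly_mult w'_def by (simp add: algebra_simps smult_diff_right)
    then have "rel_poly f \<phi> dvd [:w:] - ?R"
      using R1(2) R2(2) by (metis dvd_add dvd_diff dvd_mult dvd_triv_left)
    ultimately show ?thesis by blast
  qed
qed

lemma Z_reduced_representative:
  fixes f :: "'k::field poly"
  assumes monic: "Polynomial.lead_coeff \<phi> = 1" and pos: "0 < Polynomial.degree \<phi>"
  obtains R where "Z_reduced (Polynomial.degree \<phi>) R" and "rel_poly f \<phi> dvd V - R"
proof -
  have "\<exists>R. Z_reduced (Polynomial.degree \<phi>) R \<and> rel_poly f \<phi> dvd V - R"
  proof (induction V)
    case 0
    show ?case using pos by (intro exI[of _ 0]) (simp add: Z_reduced_0)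
  next
    case (pCons w V)
    obtain R1 where R1: "Z_reduced (Polynomial.degree \<phi>) R1" "rel_poly f \<phi> dvd [:w:] - R1"
      using Z_reduced_representative_KXZ[OF assms] by blast
    obtain R2 where R2: "Z_reduced (Polynomial.degree \<phi>) R2" "rel_poly f \<phi> dvd V - R2"
      using pCons.IH by blast
    have "Z_reduced (Polynomial.degree \<phi>) (R1 + pCons 0 R2)"
      using R1 R2 pos by (intro Z_reduced_add) (auto simp: Z_reduced_pCons)
    moreover have "pCons w V - (R1 + pCons 0 R2) = ([:w:] - R1) + [:0, 1:] * (V - R2)"
      by (simp add: algebra_simps)
    then have "rel_poly f \<phi> dvd pCons w V - (R1 + pCons 0 R2)"
      using R1(2) R2(2) by (metis dvd_add dvd_mult)
    ultimately show ?case by blast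
  qed
  then show thesis using that by blast
qed

text \<open>
  Multiplying a reduced polynomial by an element of \<open>K[X]\<close> leaves it reduced, so \<open>h R\<close> can only vanish
  modulo the relation if it vanishes outright.
\<close>

lemma KX_nonzerodivisor:
  fixes f :: "'k::field poly"
  assumes monic: "Polynomial.lead_coeff \<phi> = 1" and pos: "0 < Polynomial.degree \<phi>" and "h \<noteq> 0"
    and dvd: "rel_poly f \<phi> dvd of_KX h * V"
  shows "rel_poly f \<phi> dvd V"
proof -
  obtain R where R: "Z_reduced (Polynomial.degree \<phi>) R" "rel_poly f \<phi> dvd V - R"
    using Z_reduced_representative[OF monic pos] by blast
  have "of_KX h * R = of_KX h * V - of_KX h * (V - R)" by (simp add: algebra_simps)
  then have "rel_poly f \<phi> dvd of_KX h * R"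
    using dvd R(2) by (metis dvd_diff dvd_mult)
  moreover have "Z_reduced (Polynomial.degree \<phi>) (of_KX h * R)"
    using Z_reduced_smult_KX[OF R(1)] by (simp add: of_KX_def of_KXZ_def)
  ultimately have "of_KX h * R = 0" by (rule Z_reduced_multiple_eq_0[OF monic])
  then have "R = 0" using \<open>h \<noteq> 0\<close> by (simp add: of_KX_def of_KXZ_def)
  then show ?thesis using R(2) by simp
qed

text \<open>
  The relation has degree \<open>1\<close> in \<open>Y\<close>. This makes \<open>x\<close> and \<open>z\<close> algebraically independent over \<open>K\<close> in
  \<open>K[X,Y,Z] / (f Y - \<phi>)\<close>.
\<close>

lemma KXZ_multiple_eq_0:
  fixes f :: "'k::field poly"
  assumes "f \<noteq> 0" and "rel_poly f \<phi> dvd of_KXZ q"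
  shows "q = 0"
proof (rule ccontr)
  assume "q \<noteq> 0"
  then have "Polynomial.degree (rel_poly f \<phi>) \<le> Polynomial.degree [:q:]"
    using assms(2) by (intro dvd_imp_degree_le) (auto simp: of_KXZ_def)
  then show False using \<open>f \<noteq> 0\<close> by (simp add: rel_poly_def)
qed

text \<open>
  Each factor \<open>f\<close> absorbs one \<open>Y\<close> through \<open>f Y = \<phi>\<close>: in the quotient \<open>y = \<phi>(x,z) / f(x)\<close>, and
  \<open>f\<^sup>k\<close> is a common denominator.
\<close>

lemma clear_denominators:
  fixes f :: "'k::field poly"
  shows "\<exists>k q. rel_poly f \<phi> dvd of_KX (f ^ k) * V - of_KXZ q"
proof (induction V)
  case 0
  show ?case by (intro exI[of _ 0]) (simp add: of_KXZ_def)
next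
  case (pCons a V)
  then obtain k q where kq: "rel_poly f \<phi> dvd of_KX (f ^ k) * V - of_KXZ q" by blast
  have "of_KX (f ^ Suc k) * pCons a V - of_KXZ ([:f ^ Suc k:] * a + \<phi> * q)
      = [:0, [:f:]:] * (of_KX (f ^ k) * V - of_KXZ q) + rel_poly f \<phi> * of_KXZ q"
    unfolding rel_poly_mult of_KX_def of_KXZ_def by (simp add: algebra_simps)
  then have "rel_poly f \<phi> dvd of_KX (f ^ Suc k) * pCons a V - of_KXZ ([:f ^ Suc k:] * a + \<phi> * q)"
    using kq by (metis dvd_add dvd_mult dvd_triv_left)
  then show ?case by blast
qed

text \<open>
  This is the heart of the matter: if \<open>h\<close> times the class of \<open>W\<close> is a polynomial \<open>q(x,z)\<close> whose
  \<open>Z\<close>-degree equals that of \<open>\<psi>\<close>, then \<open>W\<close> is linear in \<open>Y\<close>. Indeed \<open>q = c \<psi> + r\<close> with \<open>c \<in> K[X]\<close> and \<open>r\<close>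
  of smaller degree, so \<open>q\<close> has the normal form \<open>c g Y + r\<close>; comparing it with \<open>h\<close> times the normal form
  of \<open>W\<close> coefficient by coefficient gives the claim.
\<close>

lemma linear_in_Y_representative:
  fixes g h :: "'k::field poly"
  assumes monic: "Polynomial.lead_coeff \<psi> = 1" and pos: "0 < Polynomial.degree \<psi>"
    and "h \<noteq> 0" and deg: "Polynomial.degree q = Polynomial.degree \<psi>"
    and dvd: "rel_poly g \<psi> dvd of_KX h * W - of_KXZ q"
  obtains w0 w1 where "[:h:] * w1 = [:Polynomial.lead_coeff q * g:]"
    and "q = Polynomial.smult (Polynomial.lead_coeff q) \<psi> + [:h:] * w0"
    and "rel_poly g \<psi> dvd W - [:w0, w1:]"
proof -
  define c where "c = Polynomial.lead_coeff q"
  define r where "r = q - Polynomial.smult c \<psi>"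
  obtain R where R: "Z_reduced (Polynomial.degree \<psi>) R" "rel_poly g \<psi> dvd W - R"
    using Z_reduced_representative[OF monic pos] by blast
  have "Polynomial.degree r < Polynomial.degree \<psi>"
    unfolding r_def using pos deg monic
    by (intro degree_less_if_coeff_eq_0)
      (auto simp: c_def intro: degree_diff_le degree_smult_le)
  then have red: "Z_reduced (Polynomial.degree \<psi>) [:r, [:c * g:]:]"
    using pos by (simp add: Z_reduced_pCons Z_reduced_0)
  have "Z_reduced (Polynomial.degree \<psi>) (of_KX h * R - [:r, [:c * g:]:])"
    using Z_reduced_smult_KX[OF R(1), of h]
    by (intro Z_reduced_diff red) (simp add: of_KX_def of_KXZ_def)
  moreover have "of_KX h * R - [:r, [:c * g:]:]
      = (of_KX h * W - of_KXZ q) - of_KX h * (W - R) - rel_poly g \<psi> * [:[:c:]:]"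
    unfolding rel_poly_mult r_def of_KX_def of_KXZ_def by (simp add: algebra_simps smult_diff_right)
  then have "rel_poly g \<psi> dvd of_KX h * R - [:r, [:c * g:]:]"
    using dvd R(2) by (metis dvd_diff dvd_mult dvd_triv_left)
  ultimately have "of_KX h * R - [:r, [:c * g:]:] = 0"
    using Z_reduced_multiple_eq_0[OF monic] by blast
  then have "Polynomial.smult [:h:] R = [:r, [:c * g:]:]"
    by (simp add: of_KX_def of_KXZ_def)
  from arg_cong[OF this, of "\<lambda>U. Polynomial.coeff U _"]
  have eq: "[:h:] * Polynomial.coeff R i = Polynomial.coeff [:r, [:c * g:]:] i" for i
    by (simp del: coeff_pCons)
  define w0 where "w0 = Polynomial.coeff R 0"
  define w1 where "w1 = Polynomial.coeff R 1"
  have "Polynomial.coeff R (Suc (Suc i)) = 0" for i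
    using eq[of "Suc (Suc i)"] \<open>h \<noteq> 0\<close> by simp
  then have R_eq: "R = [:w0, w1:]"
    unfolding w0_def w1_def by (intro poly_eqI) (simp add: coeff_pCons split: nat.split)
  show thesis
  proof (rule that)
    show "[:h:] * w1 = [:Polynomial.lead_coeff q * g:]"
      using eq[of 1] by (simp add: w1_def c_def)
    show "q = Polynomial.smult (Polynomial.lead_coeff q) \<psi> + [:h:] * w0"
      using eq[of 0] by (simp add: w0_def c_def r_def)
    show "rel_poly g \<psi> dvd W - [:w0, w1:]"
      using R(2) R_eq by simp
  qed
qed

text \<open>
  Modulo \<open>g Y - \<psi>\<close> the element \<open>g s + \<psi> t\<close> becomes \<open>g (s + Y t)\<close>;
  the normal form of the latter is \<open>g\<close> times a reduced polynomial, while \<open>h\<close> is its own normal form.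
  Hence \<open>(g, \<psi>) \<inter> K[X] = (g)\<close>.
\<close>

lemma dvd_if_in_KXZ_ideal:
  fixes g h :: "'k::field poly"
  assumes monic: "Polynomial.lead_coeff \<psi> = 1" and pos: "0 < Polynomial.degree \<psi>"
    and eq: "[:h:] = [:g:] * s + \<psi> * t"
  shows "g dvd h"
proof -
  obtain R where R: "Z_reduced (Polynomial.degree \<psi>) R" "rel_poly g \<psi> dvd [:s, t:] - R"
    using Z_reduced_representative[OF monic pos] by blast
  have "of_KX h - of_KX g * R = of_KX g * ([:s, t:] - R) - rel_poly g \<psi> * [:t:]"
    unfolding rel_poly_mult of_KX_def of_KXZ_def eq by (simp add: algebra_simps)
  then have "rel_poly g \<psi> dvd of_KX h - of_KX g * R"
    using R(2) by (metis dvd_diff dvd_mult dvd_triv_left)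
  moreover have "Z_reduced (Polynomial.degree \<psi>) (of_KX h - of_KX g * R)"
    using Z_reduced_smult_KX[OF R(1), of g] pos
    by (intro Z_reduced_diff) (auto simp: of_KX_def of_KXZ_def Z_reduced_pCons Z_reduced_0)
  ultimately have "of_KX h - of_KX g * R = 0"
    by (rule Z_reduced_multiple_eq_0[OF monic])
  then have "[:[:h:]:] = Polynomial.smult [:g:] R"
    by (simp add: of_KX_def of_KXZ_def)
  from arg_cong[OF this, of "\<lambda>U. Polynomial.coeff (Polynomial.coeff U 0) 0"]
  have "h = g * Polynomial.coeff (Polynomial.coeff R 0) 0"
    by simp
  then show ?thesis by simp
qed


section \<open>Affine substitutions in \<open>K[X]\<close> and triangular substitutions in \<open>K[X,Z]\<close>\<close>

lemma map_poly_hom_add: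
  assumes "h 0 = 0" "\<And>a b. h (a + b) = h a + h b"
  shows "map_poly h (p + q) = map_poly h p + map_poly h q"
  using assms by (intro poly_eqI) (simp add: coeff_map_poly)

lemma map_poly_hom_mult:
  fixes h :: "'a::comm_semiring_0 \<Rightarrow> 'b::comm_semiring_0"
  assumes h: "h 0 = 0" "\<And>a b. h (a + b) = h a + h b" "\<And>a b. h (a * b) = h a * h b"
  shows "map_poly h (p * q) = map_poly h p * map_poly h q"
  by (induction p) (simp_all add: map_poly_pCons map_poly_hom_add map_poly_smult h)

definition subst_X :: "'k::field \<Rightarrow> 'k \<Rightarrow> 'k poly \<Rightarrow> 'k poly"
  where "subst_X lam \<mu> p = pcompose p [:\<mu>, lam:]"

text \<open>
  The endomorphism \<open>X \<mapsto> lam X + \<mu>\<close>, \<open>Z \<mapsto> \<gamma> Z + D(X)\<close>. The coefficients are substituted first, as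
  \<open>D\<close> is already a polynomial in the new \<open>X\<close>.
\<close>

definition subst_XZ :: "'k::field \<Rightarrow> 'k \<Rightarrow> 'k \<Rightarrow> 'k poly \<Rightarrow> 'k poly poly \<Rightarrow> 'k poly poly"
  where "subst_XZ lam \<mu> \<gamma> D q = pcompose (map_poly (subst_X lam \<mu>) q) [:D, [:\<gamma>:]:]"

lemma subst_X_0 [simp]: "subst_X lam \<mu> 0 = 0"
  and subst_X_1 [simp]: "subst_X lam \<mu> 1 = 1"
  and subst_X_add: "subst_X lam \<mu> (p + q) = subst_X lam \<mu> p + subst_X lam \<mu> q"
  and subst_X_mult: "subst_X lam \<mu> (p * q) = subst_X lam \<mu> p * subst_X lam \<mu> q"
  and subst_X_pCons: "subst_X lam \<mu> (pCons c p) = [:c:] + [:\<mu>, lam:] * subst_X lam \<mu> p"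
  by (simp_all add: subst_X_def pcompose_1 pcompose_add pcompose_mult pcompose_pCons)

lemma degree_subst_X: "lam \<noteq> 0 \<Longrightarrow> Polynomial.degree (subst_X lam \<mu> p) = Polynomial.degree p"
  by (simp add: subst_X_def degree_pcompose)

lemma subst_X_eq_0_iff: "lam \<noteq> 0 \<Longrightarrow> subst_X lam \<mu> p = 0 \<longleftrightarrow> p = 0"
  by (simp add: subst_X_def pcompose_eq_0_iff)

lemma subst_X_inverse:
  assumes "lam \<noteq> 0"
  shows "subst_X lam \<mu> (subst_X (1 / lam) (- (\<mu> / lam)) p) = p"
  using assms by (simp add: subst_X_def pcompose_assoc [symmetric] pcompose_pCons)

lemma subst_XZ_add: "subst_XZ lam \<mu> \<gamma> D (p + q) = subst_XZ lam \<mu> \<gamma> D p + subst_XZ lam \<mu> \<gamma> D q"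
  and subst_XZ_mult: "subst_XZ lam \<mu> \<gamma> D (p * q) = subst_XZ lam \<mu> \<gamma> D p * subst_XZ lam \<mu> \<gamma> D q"
  by (simp_all add: subst_XZ_def map_poly_hom_add map_poly_hom_mult subst_X_add subst_X_mult
      pcompose_add pcompose_mult)

lemma subst_XZ_0 [simp]: "subst_XZ lam \<mu> \<gamma> D 0 = 0"
  by (simp add: subst_XZ_def)

lemma subst_XZ_pCons:
  "subst_XZ lam \<mu> \<gamma> D (pCons p q) = [:subst_X lam \<mu> p:] + [:D, [:\<gamma>:]:] * subst_XZ lam \<mu> \<gamma> D q"
  by (simp add: subst_XZ_def map_poly_pCons pcompose_pCons)

lemma subst_XZ_KX: "subst_XZ lam \<mu> \<gamma> D [:p:] = [:subst_X lam \<mu> p:]"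
  by (simp add: subst_XZ_pCons)

lemma subst_XZ_eq_0_iff:
  assumes "lam \<noteq> 0" "\<gamma> \<noteq> 0"
  shows "subst_XZ lam \<mu> \<gamma> D q = 0 \<longleftrightarrow> q = 0"
  using assms by (simp add: subst_XZ_def pcompose_eq_0_iff map_poly_eq_0_iff subst_X_eq_0_iff)

lemma degree_subst_XZ:
  assumes "lam \<noteq> 0" "\<gamma> \<noteq> 0"
  shows "Polynomial.degree (subst_XZ lam \<mu> \<gamma> D q) = Polynomial.degree q"
  using assms by (simp add: subst_XZ_def degree_pcompose degree_map_poly subst_X_eq_0_iff)

lemma lead_coeff_subst_XZ:
  assumes "lam \<noteq> 0" "\<gamma> \<noteq> 0" "Polynomial.lead_coeff q = 1"
  shows "Polynomial.lead_coeff (subst_XZ lam \<mu> \<gamma> D q) = [:\<gamma> ^ Polynomial.degree q:]"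
proof -
  have "Polynomial.lead_coeff (map_poly (subst_X lam \<mu>) q) = 1"
    using assms by (subst lead_coeff_map_poly_nz) simp_all
  then show ?thesis
    using assms
    by (simp add: subst_XZ_def lead_coeff_comp degree_map_poly subst_X_eq_0_iff poly_const_pow
        del: coeff_map_poly)
qed

lemma subst_XZ_surj:
  fixes q :: "'k::field poly poly"
  assumes "lam \<noteq> 0" "\<gamma> \<noteq> 0"
  obtains p where "subst_XZ lam \<mu> \<gamma> D p = q"
proof
  let ?r = "pcompose q [:Polynomial.smult (- 1 / \<gamma>) D, [:1 / \<gamma>:]:]"
  have "map_poly (subst_X lam \<mu>) (map_poly (subst_X (1 / lam) (- (\<mu> / lam))) ?r) = ?r"
    using assms by (simp add: map_poly_map_poly comp_def subst_X_inverse)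
  moreover have "pcompose ?r [:D, [:\<gamma>:]:] = pcompose q [:0, 1:]"
    using assms by (simp add: pcompose_assoc [symmetric] pcompose_pCons pCons_one)
  ultimately show "subst_XZ lam \<mu> \<gamma> D (map_poly (subst_X (1 / lam) (- (\<mu> / lam))) ?r) = q"
    unfolding subst_XZ_def by (simp only: pcompose_idR)
qed

section \<open>The quotient \<open>A\<close> and its subrings \<open>K[x]\<close> and \<open>K[x,z]\<close>\<close>

lemma KXYZ_simps [simp]:
  "carrier KXYZ = UNIV" "monoid.mult KXYZ p q = p * q" "add KXYZ p q = p + q"
  "one KXYZ = 1" "ring.zero KXYZ = 0"
  by (simp_all add: KXYZ_def ring_of_type_algebra_def)

lemma cring_KXYZ: "cring KXYZ"
  unfolding KXYZ_def by (rule cring_from_type_algebra)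

lemma ideal_rel_ideal: "ideal (rel_ideal f \<phi>) KXYZ"
  unfolding rel_ideal_def by (intro ring.genideal_ideal cring.axioms(1) cring_KXYZ) simp

lemma rel_ideal_eq: "rel_ideal f \<phi> = {V. rel_poly f \<phi> dvd V}"
proof -
  have "of_KX f * var_Y - of_KXZ \<phi> = rel_poly f \<phi>"
    by (simp add: rel_poly_def of_KX_def of_KXZ_def var_Y_def)
  then show ?thesis
    unfolding rel_ideal_def using cring.cgenideal_eq_genideal[OF cring_KXYZ, of "rel_poly f \<phi>"]
    by (auto simp: cgenideal_def dvd_def mult.commute)
qed

lemma img_eq_coset: "img f \<phi> p = {h + p | h. rel_poly f \<phi> dvd h}"
  by (auto simp: img_def a_r_coset_def' rel_ideal_eq)

lemma img_eq_iff: "img f \<phi> p = img f \<phi> q \<longleftrightarrow> rel_poly f \<phi> dvd p - q"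
proof
  assume "img f \<phi> p = img f \<phi> q"
  moreover have "p \<in> img f \<phi> p" unfolding img_eq_coset by (auto intro: exI[of _ 0])
  ultimately show "rel_poly f \<phi> dvd p - q" unfolding img_eq_coset by auto
next
  assume *: "rel_poly f \<phi> dvd p - q"
  show "img f \<phi> p = img f \<phi> q"
  proof (intro Set.set_eqI iffI)
    fix v assume "v \<in> img f \<phi> p"
    then obtain h where "v = h + p" "rel_poly f \<phi> dvd h" unfolding img_eq_coset by auto
    then have "v = (h + (p - q)) + q" "rel_poly f \<phi> dvd h + (p - q)" using * by simp_all
    then show "v \<in> img f \<phi> q" unfolding img_eq_coset by blast
  next
    fix v assume "v \<in> img f \<phi> q"
    then obtain h where "v = h + q" "rel_poly f \<phi> dvd h" unfolding img_eq_coset by auto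
    then have "v = (h - (p - q)) + p" "rel_poly f \<phi> dvd h - (p - q)"
      using * by (simp_all add: dvd_diff)
    then show "v \<in> img f \<phi> p" unfolding img_eq_coset by blast
  qed
qed

lemma cring_quot_ring: "cring (quot_ring f \<phi>)"
  unfolding quot_ring_def by (rule ideal.quotient_is_cring[OF ideal_rel_ideal cring_KXYZ])

lemma img_ring_hom: "img f \<phi> \<in> ring_hom KXYZ (quot_ring f \<phi>)"
  unfolding quot_ring_def img_def[abs_def] by (rule ideal.rcos_ring_hom[OF ideal_rel_ideal])

lemma carrier_quot_ring: "carrier (quot_ring f \<phi>) = range (img f \<phi>)"
  by (auto simp: quot_ring_def FactRing_def A_RCOSETS_def' img_def)

lemma img_closed [simp]: "img f \<phi> p \<in> carrier (quot_ring f \<phi>)"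
  by (simp add: carrier_quot_ring)

lemma img_add: "img f \<phi> p \<oplus>\<^bsub>quot_ring f \<phi>\<^esub> img f \<phi> q = img f \<phi> (p + q)"
  and img_mult: "img f \<phi> p \<otimes>\<^bsub>quot_ring f \<phi>\<^esub> img f \<phi> q = img f \<phi> (p * q)"
  and img_one: "\<one>\<^bsub>quot_ring f \<phi>\<^esub> = img f \<phi> 1"
  using ring_hom_add[OF img_ring_hom, of p q f \<phi>] ring_hom_mult[OF img_ring_hom, of p q f \<phi>]
    ring_hom_one[OF img_ring_hom, of f \<phi>]
  by simp_all

lemma img_zero: "\<zero>\<^bsub>quot_ring f \<phi>\<^esub> = img f \<phi> 0"
proof -
  interpret cring "quot_ring f \<phi>" by (rule cring_quot_ring)
  have "img f \<phi> 0 \<oplus>\<^bsub>quot_ring f \<phi>\<^esub> img f \<phi> 0 = img f \<phi> 0" by (simp add: img_add)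
  then show ?thesis by (metis img_closed add.l_cancel_one')
qed

lemma img_minus: "\<ominus>\<^bsub>quot_ring f \<phi>\<^esub> img f \<phi> p = img f \<phi> (- p)"
proof -
  interpret cring "quot_ring f \<phi>" by (rule cring_quot_ring)
  show ?thesis by (rule minus_equality) (simp_all add: img_add img_zero)
qed

lemma of_KXZ_hom:
  "of_KXZ (p + q) = of_KXZ p + of_KXZ q" "of_KXZ (p * q) = of_KXZ p * of_KXZ q"
  "of_KXZ (p - q) = of_KXZ p - of_KXZ q" "of_KXZ (- p) = - of_KXZ p" "of_KXZ 0 = 0" "of_KXZ 1 = 1"
  by (simp_all add: of_KXZ_def one_pCons)

lemma at_xz_add: "at_xz f \<phi> p \<oplus>\<^bsub>quot_ring f \<phi>\<^esub> at_xz f \<phi> q = at_xz f \<phi> (p + q)"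
  and at_xz_mult: "at_xz f \<phi> p \<otimes>\<^bsub>quot_ring f \<phi>\<^esub> at_xz f \<phi> q = at_xz f \<phi> (p * q)"
  and at_xz_minus: "\<ominus>\<^bsub>quot_ring f \<phi>\<^esub> at_xz f \<phi> p = at_xz f \<phi> (- p)"
  and at_xz_one: "\<one>\<^bsub>quot_ring f \<phi>\<^esub> = at_xz f \<phi> 1"
  and at_xz_zero: "\<zero>\<^bsub>quot_ring f \<phi>\<^esub> = at_xz f \<phi> 0"
  by (simp_all add: at_xz_def img_add img_mult img_minus img_one img_zero of_KXZ_hom)

lemma at_xz_closed: "at_xz f \<phi> q \<in> carrier (quot_ring f \<phi>)"
  by (simp add: at_xz_def)

lemma scal_eq_at_xz: "scal f \<phi> c = at_xz f \<phi> [:[:c:]:]"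
  and gen_x_eq_at_xz: "gen_x f \<phi> = at_xz f \<phi> [:[:0, 1:]:]"
  and gen_z_eq_at_xz: "gen_z f \<phi> = at_xz f \<phi> [:0, 1:]"
  and at_x_eq_at_xz: "at_x f \<phi> p = at_xz f \<phi> [:p:]"
  by (simp_all add: scal_def gen_x_def gen_z_def at_x_def at_xz_def of_K_def of_KX_def var_X_def
      var_Z_def)

lemma at_xz_inj: "f \<noteq> 0 \<Longrightarrow> at_xz f \<phi> p = at_xz f \<phi> q \<longleftrightarrow> p = q"
  using KXZ_multiple_eq_0[of f \<phi> "p - q"] by (auto simp: at_xz_def img_eq_iff of_KXZ_hom)

text \<open>
  Two homomorphisms that agree on constants and variables are equal, and a subring containing these is
  the whole ring. The following two rules express this for \<open>K[X]\<close> and \<open>K[X,Z]\<close>.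
\<close>

lemma KX_poly_induct [case_names const var add mult]:
  fixes p :: "'k::field poly"
  assumes "\<And>c. P [:c:]" and "P [:0, 1:]"
    and "\<And>p q. P p \<Longrightarrow> P q \<Longrightarrow> P (p + q)" and "\<And>p q. P p \<Longrightarrow> P q \<Longrightarrow> P (p * q)"
  shows "P p"
proof (induction p)
  case 0
  show ?case using assms(1)[of 0] by simp
next
  case (pCons a p)
  have "pCons a p = [:a:] + [:0, 1:] * p" by simp
  then show ?case using assms(1) assms(2) assms(3) assms(4) pCons.IH by metis
qed

lemma KXZ_poly_induct [case_names const var_X var_Z add mult]:
  fixes q :: "'k::field poly poly"
  assumes c: "\<And>c. P [:[:c:]:]" and x: "P [:[:0, 1:]:]" and z: "P [:0, 1:]"
    and add: "\<And>p q. P p \<Longrightarrow> P q \<Longrightarrow> P (p + q)" and mult: "\<And>p q. P p \<Longrightarrow> P q \<Longrightarrow> P (p * q)"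
  shows "P q"
proof -
  have KX: "P [:p:]" for p
  proof (induction p rule: KX_poly_induct)
    case (add p q) then show ?case using assms(4)[of "[:p:]" "[:q:]"] by simp
  next
    case (mult p q) then show ?case using assms(5)[of "[:p:]" "[:q:]"] by (simp add: mult.commute)
  qed (simp_all add: c x)
  show ?thesis
  proof (induction q)
    case 0
    show ?case using KX[of 0] by simp
  next
    case (pCons a q)
    have "pCons a q = [:a:] + [:0, 1:] * q" by simp
    then show ?case using KX z add mult pCons.IH by metis
  qed
qed

lemma carrier_K_xz: "carrier (K_xz f \<phi>) = range (at_xz f \<phi>)"
proof -
  interpret cring "quot_ring f \<phi>" by (rule cring_quot_ring)
  let ?S = "range (scal f \<phi>) \<union> {gen_x f \<phi>, gen_z f \<phi>}"
  have "h \<in> range (at_xz f \<phi>)" if "h \<in> generate_ring (quot_ring f \<phi>) ?S" for h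
    using that
    by (induction rule: generate_ring.induct)
      (auto simp: at_xz_add at_xz_mult at_xz_minus at_xz_one scal_eq_at_xz gen_x_eq_at_xz
        gen_z_eq_at_xz)
  moreover have "at_xz f \<phi> q \<in> generate_ring (quot_ring f \<phi>) ?S" for q
  proof (induction q rule: KXZ_poly_induct)
    case (add p q)
    then show ?case using generate_ring.eng_add by (metis at_xz_add)
  next
    case (mult p q)
    then show ?case using generate_ring.eng_mult by (metis at_xz_mult)
  qed (auto intro!: generate_ring.incl simp: scal_eq_at_xz gen_x_eq_at_xz gen_z_eq_at_xz)
  ultimately show ?thesis by (auto simp: K_xz_def)
qed

lemma K_x_elem_at_x:
  assumes "a \<in> carrier (K_x f \<phi>)"
  obtains D where "a = at_x f \<phi> D"
proof -
  have "a \<in> generate_ring (quot_ring f \<phi>) (range (scal f \<phi>) \<union> {gen_x f \<phi>})"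
    using assms by (simp add: K_x_def)
  then have "\<exists>D. a = at_xz f \<phi> [:D:]"
  proof (induction rule: generate_ring.induct)
    case one
    show ?case by (rule exI[of _ 1]) (simp add: at_xz_one one_pCons)
  next
    case (incl h)
    then show ?case by (auto simp: scal_eq_at_xz gen_x_eq_at_xz)
  next
    case (a_inv h)
    then show ?case by (metis at_xz_minus minus_pCons minus_zero)
  next
    case (eng_add h1 h2)
    then obtain p q where "h1 = at_xz f \<phi> [:p:]" "h2 = at_xz f \<phi> [:q:]" by blast
    then show ?case by (auto simp: at_xz_add)
  next
    case (eng_mult h1 h2)
    then obtain p q where "h1 = at_xz f \<phi> [:p:]" "h2 = at_xz f \<phi> [:q:]" by blast
    then show ?case by (auto simp: at_xz_mult)
  qed
  then show thesis using that by (auto simp: at_x_eq_at_xz)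
qed

lemma ring_K_xz: "ring (K_xz f \<phi>)"
proof -
  interpret cring "quot_ring f \<phi>" by (rule cring_quot_ring)
  show ?thesis unfolding K_xz_def
    by (rule generate_ring_is_ring) (auto simp: scal_eq_at_xz gen_x_eq_at_xz gen_z_eq_at_xz at_xz_closed)
qed

lemma K_xz_ops [simp]:
  "monoid.mult (K_xz f \<phi>) = monoid.mult (quot_ring f \<phi>)" "add (K_xz f \<phi>) = add (quot_ring f \<phi>)"
  "one (K_xz f \<phi>) = one (quot_ring f \<phi>)" "ring.zero (K_xz f \<phi>) = ring.zero (quot_ring f \<phi>)"
  by (simp_all add: K_xz_def)

lemma K_xz_minus: "\<ominus>\<^bsub>K_xz f \<phi>\<^esub> at_xz f \<phi> q = at_xz f \<phi> (- q)"
  by (rule abelian_group.minus_equality[OF ring.is_abelian_group[OF ring_K_xz]])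
    (simp_all add: carrier_K_xz at_xz_add at_xz_zero)

text \<open>
  Every element of \<open>K[x,z]\<close> is the value of a polynomial, so computations with this ideal can be carried
  out in \<open>K[X,Z]\<close>.
\<close>

lemma genideal_K_xz:
  "genideal (K_xz f \<phi>) {at_xz f \<phi> a, at_xz f \<phi> b} = {at_xz f \<phi> (a * s + b * t) | s t. True}"
  (is "?G = ?J")
proof
  interpret ring "K_xz f \<phi>" by (rule ring_K_xz)
  have "ideal ?J (K_xz f \<phi>)"
  proof (rule idealI[OF ring_axioms])
    show "subgroup ?J (add_monoid (K_xz f \<phi>))"
    proof (rule add.subgroupI)
      show "?J \<subseteq> carrier (K_xz f \<phi>)" by (auto simp: carrier_K_xz)
      show "?J \<noteq> {}" by blast
      fix u assume "u \<in> ?J"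
      then obtain s t where u: "u = at_xz f \<phi> (a * s + b * t)" by blast
      have neg: "- (a * s + b * t) = a * (- s) + b * (- t)" by simp
      then show "\<ominus>\<^bsub>K_xz f \<phi>\<^esub> u \<in> ?J" unfolding u K_xz_minus neg by blast
      fix v assume "v \<in> ?J"
      then obtain s' t' where v: "v = at_xz f \<phi> (a * s' + b * t')" by blast
      have sum: "a * s + b * t + (a * s' + b * t') = a * (s + s') + b * (t + t')"
        by (simp add: algebra_simps)
      then show "u \<oplus>\<^bsub>K_xz f \<phi>\<^esub> v \<in> ?J" unfolding u v K_xz_ops at_xz_add sum by blast
    qed
    fix u v assume "u \<in> ?J" "v \<in> carrier (K_xz f \<phi>)"
    then obtain s t r where u: "u = at_xz f \<phi> (a * s + b * t)" and v: "v = at_xz f \<phi> r"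
      by (auto simp: carrier_K_xz)
    have prod: "r * (a * s + b * t) = a * (r * s) + b * (r * t)"
      "(a * s + b * t) * r = a * (s * r) + b * (t * r)" by (simp_all add: algebra_simps)
    then show "v \<otimes>\<^bsub>K_xz f \<phi>\<^esub> u \<in> ?J" "u \<otimes>\<^bsub>K_xz f \<phi>\<^esub> v \<in> ?J"
      unfolding u v K_xz_ops at_xz_mult prod by blast+
  qed
  moreover have "at_xz f \<phi> a \<in> ?J"
    by (intro CollectI exI[of _ 1] exI[of _ 0]) simp
  moreover have "at_xz f \<phi> b \<in> ?J"
    by (intro CollectI exI[of _ 0] exI[of _ 1]) simp
  ultimately show "?G \<subseteq> ?J" by (intro genideal_minimal) auto
next
  interpret ring "K_xz f \<phi>" by (rule ring_K_xz)
  have sub: "{at_xz f \<phi> a, at_xz f \<phi> b} \<subseteq> carrier (K_xz f \<phi>)" by (auto simp: carrier_K_xz)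
  interpret I: ideal ?G "K_xz f \<phi>" by (rule genideal_ideal[OF sub])
  have "at_xz f \<phi> a \<in> ?G" "at_xz f \<phi> b \<in> ?G" using genideal_self[OF sub] by auto
  then have "at_xz f \<phi> a \<otimes>\<^bsub>K_xz f \<phi>\<^esub> at_xz f \<phi> s \<oplus>\<^bsub>K_xz f \<phi>\<^esub> at_xz f \<phi> b \<otimes>\<^bsub>K_xz f \<phi>\<^esub> at_xz f \<phi> t \<in> ?G"
    for s t by (intro I.a_closed I.I_r_closed) (auto simp: carrier_K_xz)
  then show "?J \<subseteq> ?G" by (auto simp: at_xz_add at_xz_mult)
qed


section \<open>Homomorphisms that are triangular on \<open>K[x,z]\<close>\<close>

text \<open>
  The setting of the theorem, with \<open>T(x)\<close> and \<open>T(z)\<close> given as polynomials in \<open>x\<close> and \<open>z\<close>. It is a locale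
  so that the results for \<open>T\<close> can be applied to the inverse of an isomorphism, which is again triangular.
\<close>

locale triangular_hom =
  fixes f g :: "'k::field poly" and \<phi> \<psi> :: "'k poly poly"
    and T :: "'k poly poly poly set \<Rightarrow> 'k poly poly poly set"
    and lam \<mu> \<gamma> :: 'k and D :: "'k poly"
  assumes f_nz: "f \<noteq> 0" and g_nz: "g \<noteq> 0"
    and monic_\<phi>: "Polynomial.lead_coeff \<phi> = 1" and monic_\<psi>: "Polynomial.lead_coeff \<psi> = 1"
    and degree_pos: "0 < Polynomial.degree \<psi>"
    and degree_eq: "Polynomial.degree \<phi> = Polynomial.degree \<psi>"
    and T_alg_hom: "T \<in> K_alg_hom f \<phi> g \<psi>"
    and T_gen_x: "T (gen_x f \<phi>) = at_xz g \<psi> [:[:\<mu>, lam:]:]"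
    and T_gen_z: "T (gen_z f \<phi>) = at_xz g \<psi> [:D, [:\<gamma>:]:]"
    and lam_nz: "lam \<noteq> 0" and \<gamma>_nz: "\<gamma> \<noteq> 0"
begin

abbreviation \<sigma>\<^sub>X where "\<sigma>\<^sub>X \<equiv> subst_X lam \<mu>"

abbreviation \<sigma> where "\<sigma> \<equiv> subst_XZ lam \<mu> \<gamma> D"

lemma T_hom: "T \<in> ring_hom (quot_ring f \<phi>) (quot_ring g \<psi>)"
  using T_alg_hom by (simp add: K_alg_hom_def)

lemma T_scal: "T (scal f \<phi> c) = scal g \<psi> c"
  using T_alg_hom by (simp add: K_alg_hom_def)

lemma T_at_xz: "T (at_xz f \<phi> q) = at_xz g \<psi> (\<sigma> q)"
proof (induction q rule: KXZ_poly_induct)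
  case (const c)
  show ?case using T_scal[of c] by (simp add: scal_eq_at_xz subst_XZ_KX subst_X_pCons)
next
  case var_X
  show ?case using T_gen_x by (simp add: gen_x_eq_at_xz subst_XZ_KX subst_X_pCons)
next
  case var_Z
  show ?case using T_gen_z by (simp add: gen_z_eq_at_xz subst_XZ_pCons subst_X_pCons)
next
  case (add p q)
  then show ?case
    using ring_hom_add[OF T_hom at_xz_closed at_xz_closed] by (simp add: at_xz_add subst_XZ_add)
next
  case (mult p q)
  then show ?case
    using ring_hom_mult[OF T_hom at_xz_closed at_xz_closed] by (simp add: at_xz_mult subst_XZ_mult)
qed

lemma relation_in_quotient: "at_xz f \<phi> [:f:] \<otimes>\<^bsub>quot_ring f \<phi>\<^esub> img f \<phi> var_Y = at_xz f \<phi> \<phi>"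
proof -
  have "of_KXZ [:f:] * var_Y - of_KXZ \<phi> = rel_poly f \<phi>"
    by (simp add: of_KXZ_def var_Y_def rel_poly_def)
  then show ?thesis by (simp add: at_xz_def img_mult img_eq_iff)
qed

text \<open>
  Applying \<open>T\<close> to \<open>f(x) y = \<phi>(x,z)\<close> shows that \<open>\<sigma>(f) T(y)\<close> lies in \<open>K[x,z]\<close> and has \<open>Z\<close>-degree
  \<open>d = deg\<^sub>Z \<psi>\<close> and leading coefficient \<open>\<gamma>\<^sup>d\<close>. Up to the unit \<open>\<gamma>\<^sup>d\<close>, the cofactor of \<open>\<sigma>(f)\<close> in \<open>g\<close> is the
  coefficient \<open>w\<^sub>1\<close> of \<open>y\<close> in \<open>T(y)\<close>, so \<open>w\<^sub>1\<close> decides whether \<open>T\<close> is an isomorphism.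
\<close>

lemma T_image_of_y:
  obtains w0 w1 where "T (img f \<phi> var_Y) = img g \<psi> [:w0, w1:]"
    and "[:\<sigma>\<^sub>X f:] * w1 = [:Polynomial.smult (\<gamma> ^ Polynomial.degree \<psi>) g:]"
    and "\<sigma> \<phi> = Polynomial.smult [:\<gamma> ^ Polynomial.degree \<psi>:] \<psi> + [:\<sigma>\<^sub>X f:] * w0"
proof -
  have "T (img f \<phi> var_Y) \<in> carrier (quot_ring g \<psi>)"
    by (rule ring_hom_closed[OF T_hom img_closed])
  then obtain W where W: "T (img f \<phi> var_Y) = img g \<psi> W" by (auto simp: carrier_quot_ring)
  have "at_xz g \<psi> [:\<sigma>\<^sub>X f:] \<otimes>\<^bsub>quot_ring g \<psi>\<^esub> img g \<psi> W = at_xz g \<psi> (\<sigma> \<phi>)"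
    using ring_hom_mult[OF T_hom at_xz_closed img_closed, of "[:f:]" var_Y]
    by (simp add: relation_in_quotient W T_at_xz subst_XZ_KX)
  then have "rel_poly g \<psi> dvd of_KX (\<sigma>\<^sub>X f) * W - of_KXZ (\<sigma> \<phi>)"
    by (simp add: at_xz_def img_mult img_eq_iff of_KX_def)
  moreover have "Polynomial.degree (\<sigma> \<phi>) = Polynomial.degree \<psi>"
    using degree_subst_XZ[OF lam_nz \<gamma>_nz] degree_eq by simp
  moreover have lc: "Polynomial.lead_coeff (\<sigma> \<phi>) = [:\<gamma> ^ Polynomial.degree \<psi>:]"
    using lead_coeff_subst_XZ[OF lam_nz \<gamma>_nz monic_\<phi>] degree_eq by simp
  moreover have "\<sigma>\<^sub>X f \<noteq> 0" using f_nz lam_nz by (simp add: subst_X_eq_0_iff)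
  ultimately obtain w0 w1
    where "[:\<sigma>\<^sub>X f:] * w1 = [:[:\<gamma> ^ Polynomial.degree \<psi>:] * g:]"
    and "\<sigma> \<phi> = Polynomial.smult [:\<gamma> ^ Polynomial.degree \<psi>:] \<psi> + [:\<sigma>\<^sub>X f:] * w0"
    and "rel_poly g \<psi> dvd W - [:w0, w1:]"
    using linear_in_Y_representative[OF monic_\<psi> degree_pos, of "\<sigma>\<^sub>X f" "\<sigma> \<phi>" g W] by metis
  then show thesis using W by (intro that) (simp_all add: img_eq_iff)
qed

lemma subst_f_dvd_g: "\<sigma>\<^sub>X f dvd g"
proof -
  obtain w1 where "[:\<sigma>\<^sub>X f:] * w1 = [:Polynomial.smult (\<gamma> ^ Polynomial.degree \<psi>) g:]"
    by (rule T_image_of_y)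
  from arg_cong[OF this, of "\<lambda>q. Polynomial.coeff q 0"]
  have "\<sigma>\<^sub>X f dvd Polynomial.smult (\<gamma> ^ Polynomial.degree \<psi>) g"
    by (simp add: dvd_def) metis
  then show ?thesis using \<gamma>_nz by (simp add: dvd_smult_iff)
qed

lemma degree_f_le: "Polynomial.degree f \<le> Polynomial.degree g"
  using dvd_imp_degree_le[OF subst_f_dvd_g g_nz] by (simp add: degree_subst_X lam_nz)

text \<open>
  If \<open>T\<close> identifies two elements, then multiplying their difference by a power of \<open>f(x)\<close> gives an
  element \<open>r(x,z)\<close> with \<open>\<sigma>(r) = 0\<close>; as \<open>\<sigma>\<close> is injective and \<open>f(x)\<close> is not a zero divisor, the difference
  vanishes.
\<close>

lemma T_inj: "inj_on T (carrier (quot_ring f \<phi>))"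
proof (rule inj_onI)
  fix a b assume "a \<in> carrier (quot_ring f \<phi>)" "b \<in> carrier (quot_ring f \<phi>)" and eq: "T a = T b"
  then obtain p q where a: "a = img f \<phi> p" and b: "b = img f \<phi> q" by (auto simp: carrier_quot_ring)
  obtain k r where kr: "rel_poly f \<phi> dvd of_KX (f ^ k) * (p - q) - of_KXZ r"
    using clear_denominators by blast
  let ?c = "at_xz f \<phi> [:f ^ k:]"
  have "rel_poly f \<phi> dvd of_KX (f ^ k) * p - (of_KX (f ^ k) * q + of_KXZ r)"
    using kr by (simp add: algebra_simps)
  then have cab: "?c \<otimes>\<^bsub>quot_ring f \<phi>\<^esub> a
      = ?c \<otimes>\<^bsub>quot_ring f \<phi>\<^esub> b \<oplus>\<^bsub>quot_ring f \<phi>\<^esub> at_xz f \<phi> r"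
    by (simp add: a b at_xz_def img_mult img_add img_eq_iff of_KX_def)
  interpret A1: cring "quot_ring f \<phi>" by (rule cring_quot_ring)
  interpret A2: cring "quot_ring g \<psi>" by (rule cring_quot_ring)
  have closed: "?c \<otimes>\<^bsub>quot_ring f \<phi>\<^esub> b \<in> carrier (quot_ring f \<phi>)"
    by (simp add: b at_xz_closed)
  have "T (?c \<otimes>\<^bsub>quot_ring f \<phi>\<^esub> a) = T (?c \<otimes>\<^bsub>quot_ring f \<phi>\<^esub> b)"
    using ring_hom_mult[OF T_hom at_xz_closed img_closed] by (simp add: a b eq[unfolded a b])
  then have "T (?c \<otimes>\<^bsub>quot_ring f \<phi>\<^esub> b) \<oplus>\<^bsub>quot_ring g \<psi>\<^esub> T (at_xz f \<phi> r)
      = T (?c \<otimes>\<^bsub>quot_ring f \<phi>\<^esub> b)"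
    by (metis cab ring_hom_add[OF T_hom closed at_xz_closed])
  then have "T (at_xz f \<phi> r) = \<zero>\<^bsub>quot_ring g \<psi>\<^esub>"
    using ring_hom_closed[OF T_hom] closed at_xz_closed by (metis A2.add.l_cancel_one)
  then have "\<sigma> r = 0" using g_nz by (simp add: T_at_xz at_xz_zero at_xz_inj)
  then have "r = 0" using lam_nz \<gamma>_nz by (simp add: subst_XZ_eq_0_iff)
  then have "rel_poly f \<phi> dvd of_KX (f ^ k) * (p - q)" using kr by (simp add: of_KXZ_hom)
  then have "rel_poly f \<phi> dvd p - q"
    by (rule KX_nonzerodivisor[OF monic_\<phi>, rotated 2]) (use degree_pos degree_eq f_nz in simp_all)
  then show "a = b" by (simp add: a b img_eq_iff)
qed

text \<open>
  Solving \<open>X' = lam X + \<mu>\<close> and \<open>Z' = \<gamma> Z + D(X)\<close> for \<open>X\<close> and \<open>Z\<close> gives the data of the inverse: in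
  particular \<open>Z = Z' / \<gamma> - D((X' - \<mu>) / lam) / \<gamma>\<close>.
\<close>

lemma inverse_triangular_hom:
  assumes iso: "T \<in> ring_iso (quot_ring f \<phi>) (quot_ring g \<psi>)"
  shows "triangular_hom g f \<psi> \<phi> (inv_into (carrier (quot_ring f \<phi>)) T) (1 / lam) (- (\<mu> / lam))
    (1 / \<gamma>) (Polynomial.smult (- 1 / \<gamma>) (subst_X (1 / lam) (- (\<mu> / lam)) D))"
proof -
  let ?S = "inv_into (carrier (quot_ring f \<phi>)) T"
  let ?D = "Polynomial.smult (- 1 / \<gamma>) (subst_X (1 / lam) (- (\<mu> / lam)) D)"
  have S_at_xz: "?S (at_xz g \<psi> (\<sigma> q)) = at_xz f \<phi> q" for q
    using inv_into_f_f[OF T_inj at_xz_closed, of q] by (simp add: T_at_xz)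
  have "?S \<in> ring_hom (quot_ring g \<psi>) (quot_ring f \<phi>)"
    using ring_iso_set_sym[OF cring.axioms(1)[OF cring_quot_ring] iso] by (simp add: ring_iso_def)
  moreover have "?S (scal g \<psi> c) = scal f \<phi> c" for c
    using S_at_xz[of "[:[:c:]:]"] by (simp add: scal_eq_at_xz subst_XZ_KX subst_X_pCons)
  ultimately have "?S \<in> K_alg_hom g \<psi> f \<phi>" by (simp add: K_alg_hom_def)
  moreover have "?S (gen_x g \<psi>) = at_xz f \<phi> [:[:- (\<mu> / lam), 1 / lam:]:]"
    using S_at_xz[of "[:[:- (\<mu> / lam), 1 / lam:]:]"] lam_nz
    by (simp add: gen_x_eq_at_xz subst_XZ_KX subst_X_pCons)
  moreover have "\<sigma> [:?D, [:1 / \<gamma>:]:] = [:0, 1:]"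
  proof -
    have "\<sigma>\<^sub>X ?D = Polynomial.smult (- 1 / \<gamma>) D"
      using subst_X_inverse[OF lam_nz] by (simp add: subst_X_def pcompose_smult pcompose_uminus)
    then show ?thesis using \<gamma>_nz by (simp add: subst_XZ_pCons subst_X_pCons pCons_one)
  qed
  then have "?S (gen_z g \<psi>) = at_xz f \<phi> [:?D, [:1 / \<gamma>:]:]"
    using S_at_xz[of "[:?D, [:1 / \<gamma>:]:]"] by (simp add: gen_z_eq_at_xz)
  ultimately show ?thesis
    using f_nz g_nz monic_\<phi> monic_\<psi> degree_pos degree_eq lam_nz \<gamma>_nz
    by unfold_locales simp_all
qed

lemma degree_g_le_if_iso:
  assumes "T \<in> ring_iso (quot_ring f \<phi>) (quot_ring g \<psi>)"
  shows "Polynomial.degree g \<le> Polynomial.degree f"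
  by (rule triangular_hom.degree_f_le[OF inverse_triangular_hom[OF assms]])

text \<open>
  As \<open>\<sigma>(f)\<close> divides \<open>g\<close> and has the degree of \<open>f\<close>, a degree comparison decides whether the two are
  associated.
\<close>

lemma subst_f_associated_if_degree_le:
  assumes "Polynomial.degree g \<le> Polynomial.degree f"
  obtains u where "u \<noteq> 0" "\<sigma>\<^sub>X f = Polynomial.smult u g"
proof -
  obtain c where c: "g = \<sigma>\<^sub>X f * c" using subst_f_dvd_g by (elim dvdE)
  then have "c \<noteq> 0" "\<sigma>\<^sub>X f \<noteq> 0" using g_nz by auto
  then have "Polynomial.degree c = 0"
    using assms degree_mult_eq[of "\<sigma>\<^sub>X f" c] by (simp add: c[symmetric] degree_subst_X lam_nz)
  then obtain a where a: "c = [:a:]" by (rule degree_eq_zeroE)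
  with \<open>c \<noteq> 0\<close> have "a \<noteq> 0" by auto
  then have "\<sigma>\<^sub>X f = Polynomial.smult (1 / a) g" by (simp add: c a)
  with \<open>a \<noteq> 0\<close> show thesis by (intro that[of "1 / a"]) simp_all
qed

lemma T_f_eq_iff:
  "T (at_x f \<phi> f) = scal g \<psi> u \<otimes>\<^bsub>quot_ring g \<psi>\<^esub> at_x g \<psi> g \<longleftrightarrow> \<sigma>\<^sub>X f = Polynomial.smult u g"
  using g_nz by (simp add: at_x_eq_at_xz scal_eq_at_xz at_xz_mult T_at_xz subst_XZ_KX at_xz_inj)

text \<open>
  The image of \<open>T\<close> is closed under sums and products and contains \<open>K[x,z]\<close>, because \<open>\<sigma>\<close> is surjective.
  If \<open>\<sigma>(f) = u g\<close>, then \<open>w\<^sub>1\<close> is the constant \<open>\<gamma>\<^sup>d / u\<close>, and \<open>y\<close> can be recovered from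
  \<open>T(y) = w\<^sub>0 + w\<^sub>1 y\<close>.
\<close>

lemma T_surj_if_associated:
  assumes "u \<noteq> 0" and assoc: "\<sigma>\<^sub>X f = Polynomial.smult u g"
  shows "T ` carrier (quot_ring f \<phi>) = carrier (quot_ring g \<psi>)"
proof
  show "T ` carrier (quot_ring f \<phi>) \<subseteq> carrier (quot_ring g \<psi>)"
    using ring_hom_closed[OF T_hom] by blast
  obtain w0 w1 where Ty: "T (img f \<phi> var_Y) = img g \<psi> [:w0, w1:]"
    and w1: "[:\<sigma>\<^sub>X f:] * w1 = [:Polynomial.smult (\<gamma> ^ Polynomial.degree \<psi>) g:]"
    by (rule T_image_of_y)
  define c where "c = \<gamma> ^ Polynomial.degree \<psi> / u"
  have "c \<noteq> 0" using \<open>u \<noteq> 0\<close> \<gamma>_nz by (simp add: c_def)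
  have "[:\<sigma>\<^sub>X f:] * [:[:c:]:] = [:Polynomial.smult (\<gamma> ^ Polynomial.degree \<psi>) g:]"
    unfolding assoc using \<open>u \<noteq> 0\<close> by (simp add: c_def)
  then have "[:\<sigma>\<^sub>X f:] * w1 = [:\<sigma>\<^sub>X f:] * [:[:c:]:]"
    using w1 by simp
  moreover have "[:\<sigma>\<^sub>X f:] \<noteq> 0" using f_nz lam_nz by (simp add: subst_X_eq_0_iff)
  ultimately have w1_eq: "w1 = [:[:c:]:]" by (rule mult_left_cancel[THEN iffD1, rotated])
  let ?T_img = "T ` carrier (quot_ring f \<phi>)"
  have add: "a \<oplus>\<^bsub>quot_ring g \<psi>\<^esub> b \<in> ?T_img" and mult: "a \<otimes>\<^bsub>quot_ring g \<psi>\<^esub> b \<in> ?T_img"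
    if "a \<in> ?T_img" "b \<in> ?T_img" for a b
  proof -
    interpret A1: cring "quot_ring f \<phi>" by (rule cring_quot_ring)
    from that(1) obtain a' where a': "a' \<in> carrier (quot_ring f \<phi>)" "a = T a'" by (elim imageE)
    from that(2) obtain b' where b': "b' \<in> carrier (quot_ring f \<phi>)" "b = T b'" by (elim imageE)
    note ab = a' b'
    have "a \<oplus>\<^bsub>quot_ring g \<psi>\<^esub> b = T (a' \<oplus>\<^bsub>quot_ring f \<phi>\<^esub> b')"
      "a \<otimes>\<^bsub>quot_ring g \<psi>\<^esub> b = T (a' \<otimes>\<^bsub>quot_ring f \<phi>\<^esub> b')"
      using ring_hom_add[OF T_hom] ring_hom_mult[OF T_hom] ab by simp_all
    then show "a \<oplus>\<^bsub>quot_ring g \<psi>\<^esub> b \<in> ?T_img" "a \<otimes>\<^bsub>quot_ring g \<psi>\<^esub> b \<in> ?T_img"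
      using ab A1.a_closed A1.m_closed by simp_all
  qed
  have KXZ: "at_xz g \<psi> q \<in> ?T_img" for q
  proof -
    obtain p where "\<sigma> p = q" using subst_XZ_surj[OF lam_nz \<gamma>_nz] by blast
    then have eq: "at_xz g \<psi> q = T (at_xz f \<phi> p)" by (simp add: T_at_xz)
    show ?thesis unfolding eq by (intro imageI at_xz_closed)
  qed
  have Y: "img g \<psi> var_Y \<in> ?T_img"
  proof -
    have "var_Y = of_KXZ [:[:1 / c:]:] * ([:w0, w1:] + of_KXZ (- w0))"
      using \<open>c \<noteq> 0\<close> by (simp add: var_Y_def of_KXZ_def w1_eq pCons_one)
    then have "img g \<psi> var_Y = at_xz g \<psi> [:[:1 / c:]:] \<otimes>\<^bsub>quot_ring g \<psi>\<^esub>
        (T (img f \<phi> var_Y) \<oplus>\<^bsub>quot_ring g \<psi>\<^esub> at_xz g \<psi> (- w0))"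
      by (simp add: Ty at_xz_def img_mult img_add)
    moreover have "T (img f \<phi> var_Y) \<in> ?T_img" by simp
    ultimately show ?thesis using KXZ add mult by metis
  qed
  have "img g \<psi> V \<in> ?T_img" for V
  proof (induction V)
    case 0
    show ?case using KXZ[of 0] by (simp add: at_xz_def of_KXZ_hom)
  next
    case (pCons a V)
    have "pCons a V = of_KXZ a + var_Y * V" by (simp add: of_KXZ_def var_Y_def)
    then have "img g \<psi> (pCons a V)
        = at_xz g \<psi> a \<oplus>\<^bsub>quot_ring g \<psi>\<^esub> (img g \<psi> var_Y \<otimes>\<^bsub>quot_ring g \<psi>\<^esub> img g \<psi> V)"
      by (simp add: at_xz_def img_add img_mult)
    then show ?case using KXZ Y add mult pCons.IH by metis
  qed
  then show "carrier (quot_ring g \<psi>) \<subseteq> ?T_img" by (auto simp: carrier_quot_ring)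
qed

lemma iso_iff_associated:
  "T \<in> ring_iso (quot_ring f \<phi>) (quot_ring g \<psi>) \<longleftrightarrow> (\<exists>u. u \<noteq> 0 \<and> \<sigma>\<^sub>X f = Polynomial.smult u g)"
proof
  assume "T \<in> ring_iso (quot_ring f \<phi>) (quot_ring g \<psi>)"
  from subst_f_associated_if_degree_le[OF degree_g_le_if_iso[OF this]]
  show "\<exists>u. u \<noteq> 0 \<and> \<sigma>\<^sub>X f = Polynomial.smult u g" by metis
next
  assume "\<exists>u. u \<noteq> 0 \<and> \<sigma>\<^sub>X f = Polynomial.smult u g"
  then have "T ` carrier (quot_ring f \<phi>) = carrier (quot_ring g \<psi>)"
    using T_surj_if_associated by blast
  then show "T \<in> ring_iso (quot_ring f \<phi>) (quot_ring g \<psi>)"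
    using T_hom T_inj by (simp add: ring_iso_def bij_betw_def)
qed

text \<open>
  Since \<open>K[X,Z] \<rightarrow> A\<close> is injective and \<open>\<sigma>\<close> is surjective, condition (II) is an equality of two ideals
  of \<open>K[X,Z]\<close>.
\<close>

lemma image_ideal_eq_iff:
  "T ` genideal (K_xz f \<phi>) {at_x f \<phi> f, at_xz f \<phi> \<phi>} = genideal (K_xz g \<psi>) {at_x g \<psi> g, at_xz g \<psi> \<psi>}
    \<longleftrightarrow> {[:\<sigma>\<^sub>X f:] * s + \<sigma> \<phi> * t | s t. True} = {[:g:] * s + \<psi> * t | s t. True}"
proof -
  have "T ` genideal (K_xz f \<phi>) {at_x f \<phi> f, at_xz f \<phi> \<phi>}
      = at_xz g \<psi> ` {[:\<sigma>\<^sub>X f:] * s + \<sigma> \<phi> * t | s t. True}" (is "?L = ?R")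
  proof
    show "?L \<subseteq> ?R"
      unfolding at_x_eq_at_xz genideal_K_xz
    proof clarify
      fix s t
      have "T (at_xz f \<phi> ([:f:] * s + \<phi> * t)) = at_xz g \<psi> ([:\<sigma>\<^sub>X f:] * \<sigma> s + \<sigma> \<phi> * \<sigma> t)"
        by (simp add: T_at_xz subst_XZ_add subst_XZ_mult subst_XZ_KX del: mult_pCons_left)
      then show "T (at_xz f \<phi> ([:f:] * s + \<phi> * t)) \<in> ?R" by blast
    qed
    show "?R \<subseteq> ?L"
    proof clarify
      fix s t
      obtain s' t' where "\<sigma> s' = s" "\<sigma> t' = t" using subst_XZ_surj[OF lam_nz \<gamma>_nz] by metis
      then have "at_xz g \<psi> ([:\<sigma>\<^sub>X f:] * s + \<sigma> \<phi> * t) = T (at_xz f \<phi> ([:f:] * s' + \<phi> * t'))"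
        by (simp add: T_at_xz subst_XZ_add subst_XZ_mult subst_XZ_KX del: mult_pCons_left)
      then show "at_xz g \<psi> ([:\<sigma>\<^sub>X f:] * s + \<sigma> \<phi> * t) \<in> ?L"
        unfolding at_x_eq_at_xz genideal_K_xz by blast
    qed
  qed
  moreover have "genideal (K_xz g \<psi>) {at_x g \<psi> g, at_xz g \<psi> \<psi>}
      = at_xz g \<psi> ` {[:g:] * s + \<psi> * t | s t. True}"
    unfolding at_x_eq_at_xz genideal_K_xz by blast
  moreover have "inj (at_xz g \<psi>)" using at_xz_inj[OF g_nz] by (auto intro: injI)
  ultimately show ?thesis by (simp only: inj_image_eq_iff)
qed

lemma image_ideal_iff_associated:
  "T ` genideal (K_xz f \<phi>) {at_x f \<phi> f, at_xz f \<phi> \<phi>} = genideal (K_xz g \<psi>) {at_x g \<psi> g, at_xz g \<psi> \<psi>}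
    \<longleftrightarrow> (\<exists>u. u \<noteq> 0 \<and> \<sigma>\<^sub>X f = Polynomial.smult u g)"
  unfolding image_ideal_eq_iff
proof
  assume eq: "{[:\<sigma>\<^sub>X f:] * s + \<sigma> \<phi> * t | s t. True} = {[:g:] * s + \<psi> * t | s t. True}"
  have "[:\<sigma>\<^sub>X f:] \<in> {[:\<sigma>\<^sub>X f:] * s + \<sigma> \<phi> * t | s t. True}"
    by (intro CollectI exI[of _ 1] exI[of _ 0]) simp
  then obtain s t where "[:\<sigma>\<^sub>X f:] = [:g:] * s + \<psi> * t" unfolding eq by blast
  then have "g dvd \<sigma>\<^sub>X f" by (rule dvd_if_in_KXZ_ideal[OF monic_\<psi> degree_pos])
  then have "Polynomial.degree g \<le> Polynomial.degree (\<sigma>\<^sub>X f)"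
    using f_nz lam_nz by (intro dvd_imp_degree_le) (simp_all add: subst_X_eq_0_iff)
  then have "Polynomial.degree g \<le> Polynomial.degree f" by (simp add: degree_subst_X lam_nz)
  from subst_f_associated_if_degree_le[OF this]
  show "\<exists>u. u \<noteq> 0 \<and> \<sigma>\<^sub>X f = Polynomial.smult u g" by metis
next
  assume "\<exists>u. u \<noteq> 0 \<and> \<sigma>\<^sub>X f = Polynomial.smult u g"
  then obtain u where "u \<noteq> 0" and assoc: "\<sigma>\<^sub>X f = Polynomial.smult u g" by blast
  define c where "c = \<gamma> ^ Polynomial.degree \<psi>"
  have "c \<noteq> 0" using \<gamma>_nz by (simp add: c_def)
  obtain w where w: "\<sigma> \<phi> = Polynomial.smult [:c:] \<psi> + [:\<sigma>\<^sub>X f:] * w"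
    unfolding c_def by (rule T_image_of_y)
  have \<sigma>f: "[:\<sigma>\<^sub>X f:] = [:g:] * [:[:u:]:]" by (simp add: assoc)
  have \<sigma>\<phi>: "\<sigma> \<phi> = \<psi> * [:[:c:]:] + [:g:] * ([:[:u:]:] * w)"
    unfolding w \<sigma>f by (simp add: algebra_simps)
  have units: "[:[:u:]:] * [:[:1 / u:]:] = 1" "[:[:c:]:] * [:[:1 / c:]:] = 1"
    using \<open>u \<noteq> 0\<close> \<open>c \<noteq> 0\<close> by (simp_all add: pCons_one)
  show "{[:\<sigma>\<^sub>X f:] * s + \<sigma> \<phi> * t | s t. True} = {[:g:] * s + \<psi> * t | s t. True}"
  proof (intro equalityI subsetI; clarify)
    fix s t
    have "[:\<sigma>\<^sub>X f:] * s + \<sigma> \<phi> * t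
        = [:g:] * ([:[:u:]:] * (s + w * t)) + \<psi> * ([:[:c:]:] * t)"
      unfolding \<sigma>f \<sigma>\<phi> by (simp only: distrib_left distrib_right mult_ac add_ac)
    then show "\<exists>s' t'. [:\<sigma>\<^sub>X f:] * s + \<sigma> \<phi> * t = [:g:] * s' + \<psi> * t' \<and> True" by blast
  next
    fix s t
    \<comment> \<open>The base change \<open>g = \<sigma>(f) / u\<close>, \<open>\<psi> = (\<sigma>(\<phi>) - \<sigma>(f) w) / c\<close> inverts the one used for the
      other inclusion.\<close>
    define t' where "t' = [:[:1 / c:]:] * t"
    define s' where "s' = [:[:1 / u:]:] * s - w * t'"
    have t: "t = [:[:c:]:] * t'" unfolding t'_def mult.assoc[symmetric] units by simp
    have "[:[:u:]:] * (s' + w * t') = [:[:u:]:] * [:[:1 / u:]:] * s"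
      unfolding s'_def by (simp only: mult.assoc diff_add_cancel)
    then have s: "s = [:[:u:]:] * (s' + w * t')" unfolding units by simp
    have "[:g:] * s + \<psi> * t = [:\<sigma>\<^sub>X f:] * s' + \<sigma> \<phi> * t'"
      unfolding s t \<sigma>f \<sigma>\<phi> by (simp only: distrib_left distrib_right mult_ac add_ac)
    then show "\<exists>s' t'. [:g:] * s + \<psi> * t = [:\<sigma>\<^sub>X f:] * s' + \<sigma> \<phi> * t' \<and> True" by blast
  qed
qed

end

theorem theorem4p2:
  fixes f g :: "'k::field poly"
    and \<phi>\<^sub>1 \<phi>\<^sub>2 :: "'k poly poly"
    and n m d\<^sub>1 d\<^sub>2 :: nat
    and T :: "'k poly poly poly set \<Rightarrow> 'k poly poly poly set"
    and lam \<mu> \<gamma> :: 'k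
    and \<delta> :: "'k poly poly poly set"
  defines "A\<^sub>1 \<equiv> quot_ring f \<phi>\<^sub>1" and "A\<^sub>2 \<equiv> quot_ring g \<phi>\<^sub>2"
  defines "x\<^sub>1 \<equiv> gen_x f \<phi>\<^sub>1" and "z\<^sub>1 \<equiv> gen_z f \<phi>\<^sub>1"
    and "x\<^sub>2 \<equiv> gen_x g \<phi>\<^sub>2" and "z\<^sub>2 \<equiv> gen_z g \<phi>\<^sub>2"
  defines "f_x\<^sub>1 \<equiv> at_x f \<phi>\<^sub>1 f" and "g_x\<^sub>2 \<equiv> at_x g \<phi>\<^sub>2 g"
    and "\<phi>\<^sub>1_x\<^sub>1z\<^sub>1 \<equiv> at_xz f \<phi>\<^sub>1 \<phi>\<^sub>1" and "\<phi>\<^sub>2_x\<^sub>2z\<^sub>2 \<equiv> at_xz g \<phi>\<^sub>2 \<phi>\<^sub>2"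
  assumes deg_f: "Polynomial.degree f \<ge> 2" and deg_g: "Polynomial.degree g \<ge> 2"
    and monic\<^sub>1: "Polynomial.lead_coeff \<phi>\<^sub>1 = 1" and monic\<^sub>2: "Polynomial.lead_coeff \<phi>\<^sub>2 = 1"
    and d\<^sub>1: "d\<^sub>1 = Polynomial.degree \<phi>\<^sub>1" "d\<^sub>1 \<ge> 2"
    and d\<^sub>2: "d\<^sub>2 = Polynomial.degree \<phi>\<^sub>2" "d\<^sub>2 \<ge> 2"
    and n: "n = num_prime_factors (K_x f \<phi>\<^sub>1) f_x\<^sub>1"
    and m: "m = num_prime_factors (K_x g \<phi>\<^sub>2) g_x\<^sub>2"
    and T: "T \<in> K_alg_hom f \<phi>\<^sub>1 g \<phi>\<^sub>2"
    and T_x: "T x\<^sub>1 = scal g \<phi>\<^sub>2 lam \<otimes>\<^bsub>A\<^sub>2\<^esub> x\<^sub>2 \<oplus>\<^bsub>A\<^sub>2\<^esub> scal g \<phi>\<^sub>2 \<mu>"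
    and T_z: "T z\<^sub>1 = scal g \<phi>\<^sub>2 \<gamma> \<otimes>\<^bsub>A\<^sub>2\<^esub> z\<^sub>2 \<oplus>\<^bsub>A\<^sub>2\<^esub> \<delta>"
    and "lam \<noteq> 0" and "\<gamma> \<noteq> 0" and "\<delta> \<in> carrier (K_x g \<phi>\<^sub>2)"
    and "n = m" and "d\<^sub>1 = d\<^sub>2"
  shows "(T \<in> ring_iso A\<^sub>1 A\<^sub>2
           \<longleftrightarrow> T ` genideal (K_xz f \<phi>\<^sub>1) {f_x\<^sub>1, \<phi>\<^sub>1_x\<^sub>1z\<^sub>1} = genideal (K_xz g \<phi>\<^sub>2) {g_x\<^sub>2, \<phi>\<^sub>2_x\<^sub>2z\<^sub>2})
       \<and> (T ` genideal (K_xz f \<phi>\<^sub>1) {f_x\<^sub>1, \<phi>\<^sub>1_x\<^sub>1z\<^sub>1} = genideal (K_xz g \<phi>\<^sub>2) {g_x\<^sub>2, \<phi>\<^sub>2_x\<^sub>2z\<^sub>2}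
           \<longleftrightarrow> (\<exists>u::'k. u \<noteq> 0 \<and> T f_x\<^sub>1 = scal g \<phi>\<^sub>2 u \<otimes>\<^bsub>A\<^sub>2\<^esub> g_x\<^sub>2))"
proof -
  obtain D where D: "\<delta> = at_x g \<phi>\<^sub>2 D" using K_x_elem_at_x[OF \<open>\<delta> \<in> carrier (K_x g \<phi>\<^sub>2)\<close>] .
  interpret triangular_hom f g \<phi>\<^sub>1 \<phi>\<^sub>2 T lam \<mu> \<gamma> D
  proof
    show "f \<noteq> 0" "g \<noteq> 0" using deg_f deg_g by auto
    show "0 < Polynomial.degree \<phi>\<^sub>2" "Polynomial.degree \<phi>\<^sub>1 = Polynomial.degree \<phi>\<^sub>2"
      using d\<^sub>1 d\<^sub>2 \<open>d\<^sub>1 = d\<^sub>2\<close> by simp_all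
    show "T (gen_x f \<phi>\<^sub>1) = at_xz g \<phi>\<^sub>2 [:[:\<mu>, lam:]:]"
      using T_x unfolding x\<^sub>1_def x\<^sub>2_def A\<^sub>2_def scal_eq_at_xz gen_x_eq_at_xz at_xz_mult at_xz_add
      by simp
    show "T (gen_z f \<phi>\<^sub>1) = at_xz g \<phi>\<^sub>2 [:D, [:\<gamma>:]:]"
      using T_z unfolding z\<^sub>1_def z\<^sub>2_def A\<^sub>2_def D at_x_eq_at_xz scal_eq_at_xz gen_z_eq_at_xz
        at_xz_mult at_xz_add
      by simp
  qed (use monic\<^sub>1 monic\<^sub>2 T \<open>lam \<noteq> 0\<close> \<open>\<gamma> \<noteq> 0\<close> in simp_all)
  show ?thesis
    unfolding A\<^sub>1_def A\<^sub>2_def f_x\<^sub>1_def g_x\<^sub>2_def \<phi>\<^sub>1_x\<^sub>1z\<^sub>1_def \<phi>\<^sub>2_x\<^sub>2z\<^sub>2_def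
      iso_iff_associated image_ideal_iff_associated T_f_eq_iff
    by simp
qed


end
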